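(* For the second order (with $n\ge 2$) and the fourth order (with $n\ge 7$) accurate diagonal-norm narrow-stencil summation-by-parts second derivative operators $D_2=H^{-1}(-A-\mathbf{e}_L\mathbf{d}_L^{\mathsf T}+\mathbf{e}_R\mathbf{d}_R^{\mathsf T})$ of Mattsson and Nordström, the corresponding $(n+1)\times(n+1)$ matrix $A$ has exactly one zero eigenvalue (counted with multiplicity).
   Context: Let $h=1/n$, rows and columns be indexed $0,1,\dots,n$, and $\mathbf{e}_L=[1,0,\dots,0]^{\mathsf T}$, $\mathbf{e}_R=[0,\dots,0,1]^{\mathsf T}$ in $\mathbb{R}^{n+1}$. In an SBP second derivative operator $D_2=H^{-1}(-A-\mathbf{e}_L\mathbf{d}_L^{\mathsf T}+\mathbf{e}_R\mathbf{d}_R^{\mathsf T})$, $H$ is symmetric positive definite, $A$ is symmetric positive semi-definite and $\mathbf{d}_L,\mathbf{d}_R$ are consistent approximations of the first derivative at the boundaries. The operators concerned are the following. Second order: $H=h\,\mathrm{diag}(\tfrac12,1,\dots,1,\tfrac12)$, $\mathbf{d}_L=\frac1h[-\tfrac32,2,-\tfrac12,0,\dots,0]^{\mathsf T}$, and $\mathbf{d}_R$ is minus the reversal of $\mathbf{d}_L$. The matrix $A$ is $\frac1h$ times the tridiagonal matrix with diagonal $(1,2,\dots,2,1)$ and all off-diagonal entries $-1$. Fourth order: $H=h\,\mathrm{diag}(\tfrac{17}{48},\tfrac{59}{48},\tfrac{43}{48},\tfrac{49}{48},1,\dots,1,\tfrac{49}{48},\tfrac{43}{48},\tfrac{59}{48},\tfrac{17}{48})$,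 $\mathbf{d}_L=\frac1h[-\tfrac{11}{6},3,-\tfrac32,\tfrac13,0,\dots,0]^{\mathsf T}$, and $\mathbf{d}_R$ is minus the reversal of $\mathbf{d}_L$. The matrix $A$ is $\frac{1}{48h}$ times the $(n+1)\times(n+1)$ matrix whose first four rows are (remaining entries zero) row 0: $(54,-59,4,1)$; row 1: $(-59,118,-59,0)$; row 2: $(4,-59,110,-59,4)$; row 3: $(1,0,-59,118,-64,4)$; whose rows $i$ with $4\le i\le n-4$ have entries $(4,-64,120,-64,4)$ in columns $i-2,\dots,i+2$ and zero elsewhere; and whose last four rows are determined by the symmetry $A_{n-i,n-j}=A_{i,j}$. *)

theory Defs
  imports
    Complex_Main
    "HOL-Library.More_List"
    "Jordan_Normal_Form.Char_Poly"
    "Jordan_Normal_Form.Gauss_Jordan_Elimination"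
begin

text \<open>All vectors and matrices have rows and columns indexed \<open>0, \<dots>, n\<close>, i.e. size \<open>n + 1\<close>, and the
  grid spacing is \<open>h = 1 / n\<close>. A narrow-stencil operator
  \<open>D\<^sub>2 = H\<^sup>-\<^sup>1 (- A - e\<^sub>L d\<^sub>L\<^sup>T + e\<^sub>R d\<^sub>R\<^sup>T)\<close> is represented by the data
  \<open>H, A, d\<^sub>L, d\<^sub>R\<close> of this decomposition.\<close>

record sbp =
  normH :: "real mat"
  stiffA :: "real mat"
  dL :: "real vec"
  dR :: "real vec"

definition spacing :: "nat \<Rightarrow> real" where
  "spacing n = 1 / real n"

definition outer :: "real vec \<Rightarrow> real vec \<Rightarrow> real mat" where
  "outer u v = mat (dim_vec u) (dim_vec v) (\<lambda>(i, j). u $ i * v $ j)"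

text \<open>\<open>mat_inverse\<close> is \<open>None\<close> only for singular matrices, so \<open>the\<close> is harmless: the norms \<open>H\<close> below are
  diagonal with positive entries.\<close>

definition sbp_D2 :: "nat \<Rightarrow> sbp \<Rightarrow> real mat" where
  "sbp_D2 n P = the (mat_inverse (normH P)) *
     (- stiffA P - outer (unit_vec (n + 1) 0) (dL P) + outer (unit_vec (n + 1) n) (dR P))"

text \<open>Diagonal norm whose weights are \<open>w\<close> at the left end, \<open>rev w\<close> at the right end and \<open>1\<close> in
  between (the two ends must not overlap: \<open>2 * length w \<le> n + 1\<close>), scaled by \<open>h\<close>.\<close>

definition boundary_norm :: "nat \<Rightarrow> real list \<Rightarrow> real mat" where
  "boundary_norm n w = spacing n \<cdot>\<^sub>m mat_diag (n + 1)
     (\<lambda>i. if i < length w then w ! i else if n - i < length w then w ! (n - i) else 1)"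

definition left_deriv :: "nat \<Rightarrow> real list \<Rightarrow> real vec" where
  "left_deriv n c = (1 / spacing n) \<cdot>\<^sub>v vec (n + 1) (nth_default 0 c)"

definition right_deriv :: "nat \<Rightarrow> real list \<Rightarrow> real vec" where
  "right_deriv n c = vec (n + 1) (\<lambda>i. - (left_deriv n c $ (n - i)))"

definition stiff2 :: "nat \<Rightarrow> real mat" where
  "stiff2 n = (1 / spacing n) \<cdot>\<^sub>m mat (n + 1) (n + 1) (\<lambda>(i, j).
     if i = j then (if i = 0 \<or> i = n then 1 else 2)
     else if i = j + 1 \<or> j = i + 1 then - 1
     else 0)"

text \<open>Entry \<open>(i, j)\<close>, for \<open>i \<le> n - 4\<close>, of the integer matrix in the fourth order stiffness matrix.
  From row \<open>4\<close> on, the five-point stencil sits in columns \<open>i - 2, \<dots>, i + 2\<close>.\<close>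

definition stencil4 :: "nat \<Rightarrow> nat \<Rightarrow> real" where
  "stencil4 i j =
    (if i < 4 then
       nth_default 0
         ([[54, - 59, 4, 1],
           [- 59, 118, - 59, 0],
           [4, - 59, 110, - 59, 4],
           [1, 0, - 59, 118, - 64, 4]] ! i) j
     else if i \<le> j + 2 then nth_default 0 [4, - 64, 120, - 64, 4] (j + 2 - i)
     else 0)"

text \<open>The last four rows, \<open>i > n - 4\<close>, are the point reflection of the first four; for \<open>n \<ge> 7\<close>
  these eight rows are distinct.\<close>

definition stiff4 :: "nat \<Rightarrow> real mat" where
  "stiff4 n = (1 / (48 * spacing n)) \<cdot>\<^sub>m mat (n + 1) (n + 1) (\<lambda>(i, j).
     if i + 4 \<le> n then stencil4 i j else stencil4 (n - i) (n - j))"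

definition mattsson_nordstrom2 :: "nat \<Rightarrow> sbp" where
  "mattsson_nordstrom2 n =
     \<lparr> normH = boundary_norm n [1 / 2],
       stiffA = stiff2 n,
       dL = left_deriv n [- 3 / 2, 2, - 1 / 2],
       dR = right_deriv n [- 3 / 2, 2, - 1 / 2] \<rparr>"

definition mattsson_nordstrom4 :: "nat \<Rightarrow> sbp" where
  "mattsson_nordstrom4 n =
     \<lparr> normH = boundary_norm n [17 / 48, 59 / 48, 43 / 48, 49 / 48],
       stiffA = stiff4 n,
       dL = left_deriv n [- 11 / 6, 3, - 3 / 2, 1 / 3],
       dR = right_deriv n [- 11 / 6, 3, - 3 / 2, 1 / 3] \<rparr>"

definition eigenvalue_multiplicity :: "'a :: field mat \<Rightarrow> 'a \<Rightarrow> nat" where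
  "eigenvalue_multiplicity M x = Polynomial.order x (char_poly M)"

end

theory Submission
  imports
    Defs
    "Jordan_Normal_Form.Schur_Decomposition"
    "Jordan_Normal_Form.DL_Rank"
begin

text \<open>Both stiffness matrices are symmetric, so it is enough that their kernel is the line of constant
  vectors: a symmetric matrix has no generalised eigenvectors beyond its eigenvectors
  (\<open>multiplicity_0_of_symmetric_one_dim_kernel\<close>).

  To find the kernel, read \<open>A x\<close> in conservation form. Each matrix is symmetric and annihilates constants,
  so \<open>A = D\<^sup>T B D\<close> with \<open>D\<close> the matrix of forward differences; entry \<open>i\<close> of \<open>A x\<close> is thus a flux coming in
  at \<open>i - 1\<close> minus a flux going out at \<open>i\<close>, where the fluxes are the entries of \<open>B D x\<close> and nothing enters
  at the left end. If \<open>A x = 0\<close>, all fluxes vanish, and it remains to see that \<open>B\<close> is nonsingular. For the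
  second order operator \<open>B\<close> is a multiple of the identity. For the fourth order operator \<open>48 h B\<close> is
  tridiagonal with entries \<open>-4, 56, -4\<close> in the interior, and its first rows \<open>(54, -5, -1)\<close>,
  \<open>(-5, 54, -1)\<close> and \<open>(-1, -1, 54, -4)\<close> are dominated by their diagonal entries as well; the last rows
  are their reflection. At the index where the difference of \<open>x\<close> is largest in absolute value, a vanishing
  flux then forces that difference to be zero (\<open>const_of_stencil4_eq_0\<close>), so \<open>x\<close> is constant. The right end
  is treated by applying the left-end argument to the reversed vector.\<close>

section \<open>Multiplicity of the zero eigenvalue of a symmetric matrix\<close>

text \<open>Conjugating a matrix by such a \<open>P\<close> turns the eigenvector \<open>v\<close> into the first unit vector, which makes
  the first column of the conjugate known.\<close>

lemma ex_basis_change_col0: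
  fixes v :: "'a :: field vec"
  assumes v: "v \<in> carrier_vec n" "v \<noteq> 0\<^sub>v n"
  obtains P Q where "P \<in> carrier_mat n n" "Q \<in> carrier_mat n n" "P * Q = 1\<^sub>m n" "Q * P = 1\<^sub>m n"
    "col P 0 = v"
proof -
  interpret vec_space "TYPE('a)" n .
  note basis = basis_completion[OF v]
  define P where "P = mat_of_cols n (basis_completion v)"
  have P: "P \<in> carrier_mat n n"
    unfolding P_def using basis(6) by (metis mat_of_cols_carrier(1))
  have cols: "cols P = basis_completion v"
    unfolding P_def using basis(2) by (simp add: cols_mat_of_cols)
  have "det P \<noteq> 0"
  proof
    assume "det P = 0"
    then obtain x where "x \<in> carrier_vec n" "x \<noteq> 0\<^sub>v n" "P *\<^sub>v x = 0\<^sub>v n"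
      using det_0_iff_vec_prod_zero_field[OF P] by blast
    then have "lin_dep (set (cols P))"
      using lin_depI[OF P] basis(4) cols by simp
    with basis(5) cols show False by simp
  qed
  from det_non_zero_imp_unit[OF P this, of "()"]
  obtain Q where Q: "Q \<in> carrier_mat n n" "P * Q = 1\<^sub>m n" "Q * P = 1\<^sub>m n"
    unfolding Units_def ring_mat_def by auto
  have "0 < n" using v by (cases n) auto
  then have "col P 0 = v"
    using cols basis(6,7) P
    by (metis (no_types) carrier_matD(2) cols_nth hd_conv_nth list.size(3) less_irrefl)
  with P Q show thesis using that by blast
qed

text \<open>For a symmetric matrix a one-dimensional kernel forces the algebraic multiplicity of \<open>0\<close> to be one
  as well. In a basis starting with \<open>v\<close> the first column vanishes, so one factor \<open>X\<close> splits off the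
  characteristic polynomial. If the remaining block were singular, some \<open>x\<close> outside the line of \<open>v\<close>
  would satisfy \<open>A x = c v\<close>; but the range of a symmetric matrix is orthogonal to its kernel, so
  \<open>c = 0\<close> and \<open>x\<close> would be a second kernel direction.\<close>

lemma multiplicity_0_of_symmetric_one_dim_kernel:
  fixes A :: "real mat"
  assumes A: "A \<in> carrier_mat n n" and sym: "A\<^sup>T = A"
    and v: "v \<in> carrier_vec n" "v \<noteq> 0\<^sub>v n" and Av: "A *\<^sub>v v = 0\<^sub>v n"
    and kernel: "\<And>x. x \<in> carrier_vec n \<Longrightarrow> A *\<^sub>v x = 0\<^sub>v n \<Longrightarrow> \<exists>t. x = t \<cdot>\<^sub>v v"
  shows "eigenvalue_multiplicity A 0 = 1"
proof -
  obtain P Q where P: "P \<in> carrier_mat n n" and Q: "Q \<in> carrier_mat n n"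
    and PQ: "P * Q = 1\<^sub>m n" and QP: "Q * P = 1\<^sub>m n" and col: "col P 0 = v"
    using ex_basis_change_col0[OF v] .
  obtain m where n: "n = Suc m" using v by (cases n) auto
  define e where "e = (unit_vec n 0 :: real vec)"
  have e: "e \<in> carrier_vec n" unfolding e_def by simp
  have Pe: "P *\<^sub>v e = v"
    unfolding e_def col[symmetric] using P n by (intro eq_vecI) auto
  have Qv: "Q *\<^sub>v v = e"
    using P Q QP e by (simp flip: Pe assoc_mult_mat_vec)
  define A' where "A' = Q * A * P"
  have A': "A' \<in> carrier_mat n n" unfolding A'_def using A P Q by simp
  have A'_mult: "A' *\<^sub>v x = Q *\<^sub>v (A *\<^sub>v (P *\<^sub>v x))" if "x \<in> carrier_vec n" for x
    unfolding A'_def using A P Q that by (simp add: assoc_mult_mat_vec[of _ n n _ n])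
  have "similar_mat A' A"
    by (rule similar_matI[of _ _ Q P n]) (use A A' P Q PQ QP in \<open>auto simp: A'_def\<close>)
  then have "char_poly A = char_poly A'" using char_poly_similar by metis
  have "A' *\<^sub>v e = 0\<^sub>v n"
    using A'_mult[OF e] Q by (auto simp: Pe Av)
  have "A' $$ (i, 0) = 0" if "i < n" for i
    using arg_cong[OF \<open>A' *\<^sub>v e = 0\<^sub>v n\<close>, of "\<lambda>x. x $ i"] that n A' unfolding e_def by simp
  then have "char_poly A' = monom 1 1 * char_poly (mat_delete A' 0 0)"
    using n A' by (intro char_poly_0_column) auto
  with \<open>char_poly A = char_poly A'\<close>
  have cp: "char_poly A = monom 1 1 * char_poly (mat_delete A' 0 0)" by simp
  let ?B = "mat_delete A' 0 0"
  have B: "?B \<in> carrier_mat m m" using mat_delete_carrier[OF A'] n by simp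
  have "\<not> eigenvalue ?B 0"
  proof
    assume "eigenvalue ?B 0"
    then obtain y where y: "y \<in> carrier_vec m" "y \<noteq> 0\<^sub>v m" "?B *\<^sub>v y = 0 \<cdot>\<^sub>v y"
      unfolding eigenvalue_def eigenvector_def carrier_matD(1)[OF B] by blast
    define z where "z = vCons 0 y"
    have z: "z \<in> carrier_vec n" unfolding z_def n using y by simp
    define x where "x = P *\<^sub>v z"
    have x: "x \<in> carrier_vec n" unfolding x_def using P z by simp
    have Qx: "Q *\<^sub>v x = z"
      unfolding x_def using P Q QP z by (simp flip: assoc_mult_mat_vec)
    \<comment> \<open>Below its first entry, \<open>A' z\<close> is the block applied to \<open>y\<close>, hence zero.\<close>
    have "(A' *\<^sub>v z) $ Suc i = (?B *\<^sub>v y) $ i" if "i < m" for i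
      using that A' y(1) n
      by (auto simp: z_def mat_delete_def scalar_prod_def sum.atLeast0_lessThan_Suc_shift
          simp del: sum.op_ivl_Suc)
    then have "A' *\<^sub>v z = (A' *\<^sub>v z) $ 0 \<cdot>\<^sub>v e"
      using A' n y(1,3) unfolding e_def
      by (intro eq_vecI) (auto simp: less_Suc_eq_0_disj)
    then obtain c where c: "A' *\<^sub>v z = c \<cdot>\<^sub>v e" by blast
    have "A *\<^sub>v x = (P * Q) *\<^sub>v (A *\<^sub>v x)" unfolding PQ using A x by simp
    also have "\<dots> = P *\<^sub>v (A' *\<^sub>v z)"
      using A P Q x A'_mult[OF z] by (simp add: x_def assoc_mult_mat_vec[of _ n n _ n])
    also have "\<dots> = c \<cdot>\<^sub>v v" unfolding c using P e by (simp add: mult_mat_vec Pe)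
    finally have Ax: "A *\<^sub>v x = c \<cdot>\<^sub>v v" .
    \<comment> \<open>Pair \<open>A x = c v\<close> with the kernel vector \<open>v\<close> and move \<open>A\<close> to the other side.\<close>
    have "c * (v \<bullet> v) = v \<bullet> (A *\<^sub>v x)" unfolding Ax using v by simp
    also have "\<dots> = (A\<^sup>T *\<^sub>v v) \<bullet> x" using A x v(1) by (simp add: transpose_vec_mult_scalar)
    also have "\<dots> = 0" unfolding sym Av using x by simp
    finally have "c = 0" using conjugate_square_eq_0_vec[OF v(1)] v(2) by simp
    then have "A *\<^sub>v x = 0\<^sub>v n" unfolding Ax using v by auto
    then obtain t where t: "x = t \<cdot>\<^sub>v v" using kernel x by blast
    have zt: "z = t \<cdot>\<^sub>v e" unfolding Qx[symmetric] t using Q v by (simp add: mult_mat_vec Qv)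
    have "t = z $ 0" unfolding zt e_def n by simp
    then have "t = 0" by (simp add: z_def)
    then have "z $ Suc i = 0" if "i < m" for i using that unfolding zt e_def n by simp
    then have "y = 0\<^sub>v m" using y(1) by (intro eq_vecI) (auto simp: z_def)
    with y(2) show False ..
  qed
  then have "poly (char_poly ?B) 0 \<noteq> 0" using eigenvalue_root_char_poly[OF B] by blast
  then have "Polynomial.order 0 (char_poly ?B) = 0" "char_poly ?B \<noteq> 0"
    by (auto simp: order_root)
  moreover have "Polynomial.order 0 (monom 1 1 :: real poly) = 1"
    using order_power_n_n[of "0::real" 1] by (simp add: monom_altdef)
  ultimately show ?thesis
    unfolding eigenvalue_multiplicity_def cp by (subst order_mult) (auto simp: monom_eq_0_iff)
qed

text \<open>The case \<open>v = (1, \<dots>, 1)\<close> of the multiplicity criterion, with the matrix given by its entries.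
  The scaling \<open>c\<close> stands for the factors \<open>1 / h\<close> and \<open>1 / (48 h)\<close>.\<close>

lemma multiplicity_0_of_kernel_constant:
  fixes a :: "nat \<Rightarrow> nat \<Rightarrow> real"
  assumes c: "c \<noteq> 0"
    and sym: "\<And>i j. i \<le> n \<Longrightarrow> j \<le> n \<Longrightarrow> a i j = a j i"
    and row_sum: "\<And>i. i \<le> n \<Longrightarrow> (\<Sum>j\<le>n. a i j) = 0"
    and kernel: "\<And>x i. (\<And>i. i \<le> n \<Longrightarrow> (\<Sum>j\<le>n. a i j * x j) = 0) \<Longrightarrow> i \<le> n \<Longrightarrow> x i = x 0"
  shows "eigenvalue_multiplicity (c \<cdot>\<^sub>m mat (n + 1) (n + 1) (\<lambda>(i, j). a i j)) 0 = 1"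
    (is "eigenvalue_multiplicity ?A 0 = 1")
proof -
  define one where "one = vec (n + 1) (\<lambda>_. 1 :: real)"
  have A: "?A \<in> carrier_mat (n + 1) (n + 1)" by simp
  have mult: "(?A *\<^sub>v x) $ i = c * (\<Sum>j\<le>n. a i j * x $ j)"
    if "x \<in> carrier_vec (n + 1)" "i \<le> n" for x i
  proof -
    have "(?A *\<^sub>v x) $ i = (\<Sum>j = 0..<n + 1. c * a i j * x $ j)"
      using that by (simp add: scalar_prod_def)
    also have "{0..<n + 1} = {..n}" by auto
    finally show ?thesis by (simp add: sum_distrib_left mult.assoc)
  qed
  show ?thesis
  proof (rule multiplicity_0_of_symmetric_one_dim_kernel[OF A])
    show "?A\<^sup>T = ?A" using sym by (intro eq_matI) auto
    show "one \<in> carrier_vec (n + 1)" by (simp add: one_def)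
    have "one $ 0 = 1" by (simp add: one_def)
    then show "one \<noteq> 0\<^sub>v (n + 1)" by auto
    show "?A *\<^sub>v one = 0\<^sub>v (n + 1)"
    proof (rule eq_vecI)
      fix i assume "i < dim_vec (0\<^sub>v (n + 1) :: real vec)"
      then show "(?A *\<^sub>v one) $ i = 0\<^sub>v (n + 1) $ i"
        using mult[of one i] row_sum[of i] by (simp add: one_def)
    qed simp
    fix x assume x: "x \<in> carrier_vec (n + 1)" and "?A *\<^sub>v x = 0\<^sub>v (n + 1)"
    then have "(\<Sum>j\<le>n. a i j * x $ j) = 0" if "i \<le> n" for i
      using mult[OF x that] that c by simp
    then have const: "x $ i = x $ 0" if "i \<le> n" for i using kernel that by blast
    have "x = x $ 0 \<cdot>\<^sub>v one"
    proof (rule eq_vecI)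
      fix i assume "i < dim_vec (x $ 0 \<cdot>\<^sub>v one)"
      then show "x $ i = (x $ 0 \<cdot>\<^sub>v one) $ i" using const[of i] by (simp add: one_def)
    qed (use x in \<open>simp add: one_def\<close>)
    then show "\<exists>t. x = t \<cdot>\<^sub>v one" ..
  qed
qed

section \<open>The second order operator\<close>

definition forward_diff :: "(nat \<Rightarrow> real) \<Rightarrow> nat \<Rightarrow> real" where
  "forward_diff x k = x (k + 1) - x k"

text \<open>With no flux through the left end, conservation in the first rows carries the zero flux
  inwards.\<close>

lemma zero_flux_propagates:
  fixes g :: "nat \<Rightarrow> real"
  assumes "\<And>i. i \<le> m \<Longrightarrow> (if i = 0 then 0 else g (i - 1)) - g i = 0" "k \<le> m"
  shows "g k = 0"
  using assms(2)
proof (induction k)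
  case 0
  with assms(1)[of 0] show ?case by simp
next
  case (Suc k)
  with assms(1)[of "Suc k"] show ?case by simp
qed

lemma const_of_forward_diff_eq_0:
  assumes "\<And>k. k < n \<Longrightarrow> forward_diff x k = 0" "i \<le> n"
  shows "x i = x 0"
  using assms(2) by (induction i) (use assms(1) in \<open>auto simp: forward_diff_def\<close>)

text \<open>For the second order operator the flux is the difference itself, so zero flux at the left end
  propagates directly to all differences.\<close>

lemma multiplicity_0_stiff2:
  assumes n: "2 \<le> n"
  shows "eigenvalue_multiplicity (stiff2 n) 0 = 1"
proof -
  define a :: "nat \<Rightarrow> nat \<Rightarrow> real" where
    "a = (\<lambda>i j. if i = j then (if i = 0 \<or> i = n then 1 else 2)
      else if i = j + 1 \<or> j = i + 1 then - 1 else 0)"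
  \<comment> \<open>Divergence form; both ends are closed.\<close>
  have row: "(\<Sum>j\<le>n. a i j * x j) =
      (if i = 0 then 0 else forward_diff x (i - 1)) - (if i = n then 0 else forward_diff x i)"
    if "i \<le> n" for i x
  proof -
    have "(\<Sum>j\<le>n. a i j * x j) = (\<Sum>j\<in>{i - 1..i + 1} \<inter> {..n}. a i j * x j)"
      by (intro sum.mono_neutral_right) (auto simp: a_def)
    also have "\<dots> =
        (if i = 0 then 0 else forward_diff x (i - 1)) - (if i = n then 0 else forward_diff x i)"
    proof -
      consider "i = 0" | "i = n" | "0 < i" "i < n" using \<open>i \<le> n\<close> by linarith
      then show ?thesis
      proof cases
        case 1
        then have "{i - 1..i + 1} \<inter> {..n} = {0, 1}" using n by auto
        then show ?thesis using 1 n by (simp add: a_def forward_diff_def)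
      next
        case 2
        then have "{i - 1..i + 1} \<inter> {..n} = {n - 1, n}" using n by auto
        then show ?thesis using 2 n by (simp add: a_def forward_diff_def)
      next
        case 3
        then obtain k where k: "i = Suc k" by (cases i) auto
        with 3 have "{i - 1..i + 1} \<inter> {..n} = {k, Suc k, Suc (Suc k)}" by auto
        then show ?thesis using 3 by (simp add: a_def forward_diff_def k)
      qed
    qed
    finally show ?thesis .
  qed
  have "eigenvalue_multiplicity
      ((1 / spacing n) \<cdot>\<^sub>m mat (n + 1) (n + 1) (\<lambda>(i, j). a i j)) 0 = 1"
  proof (rule multiplicity_0_of_kernel_constant)
    show "1 / spacing n \<noteq> 0" using n by (simp add: spacing_def)
    show "a i j = a j i" for i j by (auto simp: a_def)
    show "(\<Sum>j\<le>n. a i j) = 0" if "i \<le> n" for i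
      using row[OF that, of "\<lambda>_. 1"] by (simp add: forward_diff_def)
    fix x :: "nat \<Rightarrow> real" and i
    assume zero: "\<And>i. i \<le> n \<Longrightarrow> (\<Sum>j\<le>n. a i j * x j) = 0" and "i \<le> n"
    have "forward_diff x k = 0" if "k < n" for k
    proof (rule zero_flux_propagates)
      show "k \<le> n - 1" using that by simp
      fix i assume "i \<le> n - 1"
      then show "(if i = 0 then 0 else forward_diff x (i - 1)) - forward_diff x i = 0"
        using row[of i x] zero[of i] n by (simp split: if_splits)
    qed
    then show "x i = x 0" using const_of_forward_diff_eq_0 \<open>i \<le> n\<close> by blast
  qed
  then show ?thesis by (simp add: stiff2_def a_def)
qed

section \<open>The fourth order operator\<close>

text \<open>The values are the \<open>48 h\<close>-fold numerical fluxes: \<open>stencil4\<close> is, row by row, the negative difference of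
  consecutive fluxes. The coefficients of \<open>flux4 x k\<close> in the differences of \<open>x\<close> are found by summing the
  rows \<open>0, \<dots>, k\<close> of the stencil and changing sign; away from the boundary they reflect the factorisation
  \<open>4 - 64 z + 120 z\<^sup>2 - 64 z\<^sup>3 + 4 z\<^sup>4 = (1 - z)\<^sup>2 (4 - 56 z + 4 z\<^sup>2)\<close>.
  Each row of coefficients is strictly diagonally dominant.\<close>

definition flux4 :: "(nat \<Rightarrow> real) \<Rightarrow> nat \<Rightarrow> real" where
  "flux4 x k =
    (if k = 0 then 54 * forward_diff x 0 - 5 * forward_diff x 1 - forward_diff x 2
     else if k = 1 then - 5 * forward_diff x 0 + 54 * forward_diff x 1 - forward_diff x 2
     else if k = 2 then
       - forward_diff x 0 - forward_diff x 1 + 54 * forward_diff x 2 - 4 * forward_diff x 3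
     else - 4 * forward_diff x (k - 1) + 56 * forward_diff x k - 4 * forward_diff x (k + 1))"

text \<open>The rows are in divergence form, with zero flux into the left end. Constants have zero flux, so
  this also yields the vanishing row sums.\<close>

lemma sum_stencil4:
  assumes "7 \<le> n" "i + 4 \<le> n"
  shows "(\<Sum>j\<le>n. stencil4 i j * x j) = (if i = 0 then 0 else flux4 x (i - 1)) - flux4 x i"
proof (cases "i < 4")
  case True
  \<comment> \<open>All four boundary rows live in the columns \<open>0, \<dots>, 5\<close>.\<close>
  have zero: "stencil4 i j = 0" if "j \<notin> {..<6}" for j
    using that True by (auto simp: stencil4_def nth_default_def less_Suc_eq numeral_eq_Suc)
  have "(\<Sum>j\<le>n. stencil4 i j * x j) = (\<Sum>j<6. stencil4 i j * x j)"
    using assms by (intro sum.mono_neutral_right) (auto simp: zero)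
  also have "\<dots> = (if i = 0 then 0 else flux4 x (i - 1)) - flux4 x i"
  proof -
    consider "i = 0" | "i = 1" | "i = 2" | "i = 3" using True by linarith
    then show ?thesis
      by cases (simp_all add: eval_nat_numeral stencil4_def nth_default_def flux4_def forward_diff_def)
  qed
  finally show ?thesis .
next
  case False
  then obtain m where i: "i = m + 4" by (metis add.commute le_Suc_ex not_less)
  have zero: "stencil4 i j = 0" if "j \<notin> {m+2..m+6}" for j
    using that unfolding i by (auto simp: stencil4_def nth_default_def)
  have "(\<Sum>j\<le>n. stencil4 i j * x j) = (\<Sum>j\<in>{m+2..m+6}. stencil4 i j * x j)"
    using assms by (intro sum.mono_neutral_right) (auto simp: zero[unfolded i] i)
  also have "{m+2..m+6} = {m+2, m+3, m+4, m+5, m+6}" by auto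
  also have "(\<Sum>j\<in>\<dots>. stencil4 i j * x j) = flux4 x (i - 1) - flux4 x i"
    by (simp add: i stencil4_def nth_default_def flux4_def forward_diff_def eval_nat_numeral algebra_simps)
  finally show ?thesis by (simp add: i)
qed

text \<open>Outside the corner block \<open>i, j < 4\<close> even the boundary rows agree with the interior stencil. There
  the entries depend on \<open>\<bar>i - j\<bar>\<close> only, which on naturals is \<open>(i - j) + (j - i)\<close>.\<close>

lemma stencil4_toeplitz:
  assumes "4 \<le> i \<or> 4 \<le> j"
  shows "stencil4 i j = nth_default 0 [120, - 64, 4] ((i - j) + (j - i))"
proof (cases "4 \<le> i")
  case True
  consider "j + 2 < i" | "i = j + 2" | "i = j + 1" | "i = j" | "j = i + 1" | "j = i + 2" | "i + 2 < j"
    by linarith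
  then show ?thesis
    using True by cases (auto simp: stencil4_def nth_default_def eval_nat_numeral)
next
  case False
  then have j: "4 \<le> j" and "i = 0 \<or> i = 1 \<or> i = 2 \<or> i = 3" using assms by linarith+
  then consider "i = 0" | "i = 1" | "i = 2" "j = 4" | "i = 2" "4 < j"
    | "i = 3" "j = 4" | "i = 3" "j = 5" | "i = 3" "5 < j" by linarith
  then show ?thesis
    using j by cases (auto simp: stencil4_def nth_default_def)
qed

lemma stencil4_sym: "stencil4 i j = stencil4 j i"
proof (cases "4 \<le> i \<or> 4 \<le> j")
  case True
  then show ?thesis using stencil4_toeplitz[of i j] stencil4_toeplitz[of j i] by (metis add.commute)
next
  case False
  then have "i = 0 \<or> i = 1 \<or> i = 2 \<or> i = 3" "j = 0 \<or> j = 1 \<or> j = 2 \<or> j = 3" by linarith+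
  then show ?thesis by (elim disjE) (simp_all add: stencil4_def nth_default_def)
qed

text \<open>Diagonal dominance, with one bound for all rows: the diagonal coefficient is at least \<open>54\<close>, and
  the others have absolute sum at most \<open>8\<close>.\<close>

lemma forward_diff_le_of_flux4_eq_0:
  assumes "flux4 x k = 0" "\<And>j. j \<le> max 3 (k + 1) \<Longrightarrow> \<bar>forward_diff x j\<bar> \<le> D"
  shows "54 * \<bar>forward_diff x k\<bar> \<le> 8 * D"
proof -
  consider "k = 0" | "k = 1" | "k = 2" | "3 \<le> k" by linarith
  then show ?thesis
  proof cases
    case 4
    then show ?thesis
      using assms(1) assms(2)[of "k - 1"] assms(2)[of k] assms(2)[of "k + 1"]
      by (simp add: flux4_def) linarith
  qed (use assms(1) assms(2)[of 0] assms(2)[of 1] assms(2)[of 2] assms(2)[of 3]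
      in \<open>simp_all add: flux4_def\<close>)
qed

text \<open>The first \<open>n - 3\<close> rows control the differences \<open>0, \<dots>, n - 4\<close>, and the same rows applied to the
  reversed vector control the last \<open>n - 3\<close> ones. For \<open>n \<ge> 7\<close> these two ranges cover all \<open>n\<close> differences,
  so the dominance estimate applies to the largest one, \<open>D\<close>, whichever half it lies in, and gives
  \<open>54 D \<le> 8 D\<close>.\<close>

lemma const_of_stencil4_eq_0:
  assumes n: "7 \<le> n"
    and left: "\<And>i. i + 4 \<le> n \<Longrightarrow> (\<Sum>j\<le>n. stencil4 i j * x j) = 0"
    and right: "\<And>i. i + 4 \<le> n \<Longrightarrow> (\<Sum>j\<le>n. stencil4 i j * x (n - j)) = 0"
    and "i \<le> n"
  shows "x i = x 0"
proof -
  define y where "y = (\<lambda>j. x (n - j))"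
  have diff_y: "forward_diff y k = - forward_diff x (n - 1 - k)" if "k < n" for k
  proof -
    have "n - 1 - k + 1 = n - k" "n - 1 - k = n - (k + 1)" using that by simp_all
    then show ?thesis by (simp add: y_def forward_diff_def)
  qed
  have flux_x: "flux4 x k = 0" if "k \<le> n - 4" for k
  proof (rule zero_flux_propagates[OF _ that])
    fix i assume "i \<le> n - 4"
    then have "i + 4 \<le> n" using n by simp
    with sum_stencil4[OF n this, of x] left[OF this]
    show "(if i = 0 then 0 else flux4 x (i - 1)) - flux4 x i = 0" by metis
  qed
  have flux_y: "flux4 y k = 0" if "k \<le> n - 4" for k
  proof (rule zero_flux_propagates[OF _ that])
    fix i assume "i \<le> n - 4"
    then have "i + 4 \<le> n" using n by simp
    with sum_stencil4[OF n this, of y] right[OF this]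
    show "(if i = 0 then 0 else flux4 y (i - 1)) - flux4 y i = 0" unfolding y_def by metis
  qed
  define D where "D = Max ((\<lambda>k. \<bar>forward_diff x k\<bar>) ` {..<n})"
  have le_D: "\<bar>forward_diff x k\<bar> \<le> D" if "k < n" for k
    unfolding D_def using that by (intro Max_ge) auto
  have "D \<in> (\<lambda>k. \<bar>forward_diff x k\<bar>) ` {..<n}"
    unfolding D_def using n by (intro Max_in) (auto simp: lessThan_empty_iff)
  then obtain k where k: "k < n" "D = \<bar>forward_diff x k\<bar>" by blast
  have "54 * D \<le> 8 * D"
  proof (cases "k \<le> n - 4")
    case True
    then show ?thesis
      using forward_diff_le_of_flux4_eq_0[of x k D, OF flux_x] le_D n k(2) by simp
  next
    case False
    define k' where "k' = n - 1 - k"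
    have k': "k' \<le> n - 4" "k = n - 1 - k'" using False k(1) n by (auto simp: k'_def)
    have "54 * \<bar>forward_diff y k'\<bar> \<le> 8 * D"
    proof (rule forward_diff_le_of_flux4_eq_0[OF flux_y])
      fix j assume "j \<le> max 3 (k' + 1)"
      then have "j < n" using k'(1) n by simp
      then show "\<bar>forward_diff y j\<bar> \<le> D" using diff_y[of j] le_D[of "n - 1 - j"] by simp
    qed (fact k'(1))
    moreover have "\<bar>forward_diff y k'\<bar> = D" using k k' diff_y[of k'] n by simp
    ultimately show ?thesis by simp
  qed
  then have "D \<le> 0" by simp
  then have "forward_diff x k = 0" if "k < n" for k using le_D[OF that] by simp
  then show ?thesis using const_of_forward_diff_eq_0 \<open>i \<le> n\<close> by blast
qed

text \<open>The point reflection leaves the Toeplitz part of the stencil unchanged, so the rows taken from the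
  left and from the right description agree where they overlap. The hypotheses keep the entry out of both
  corner blocks.\<close>

lemma stencil4_reflect:
  assumes "4 \<le> i \<or> 4 \<le> j" "i + 4 \<le> n \<or> j + 4 \<le> n" "i \<le> n" "j \<le> n"
  shows "stencil4 (n - i) (n - j) = stencil4 i j"
proof -
  have "4 \<le> n - i \<or> 4 \<le> n - j" using assms(2) by linarith
  moreover have "n - i - (n - j) + (n - j - (n - i)) = i - j + (j - i)" using assms(3,4) by linarith
  ultimately show ?thesis using assms(1) by (simp add: stencil4_toeplitz)
qed

lemma sum_atMost_rev: "(\<Sum>j\<le>n::nat. f (n - j)) = (\<Sum>j\<le>n. f j)"
  by (rule sum.reindex_bij_witness[of _ "\<lambda>j. n - j" "\<lambda>j. n - j"]) auto

lemma multiplicity_0_stiff4: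
  assumes n: "7 \<le> n"
  shows "eigenvalue_multiplicity (stiff4 n) 0 = 1"
proof -
  define a where "a = (\<lambda>i j. if i + 4 \<le> n then stencil4 i j else stencil4 (n - i) (n - j))"
  \<comment> \<open>Read from the right end, the matrix starts with the same rows as from the left end.\<close>
  have reflect: "a (n - i) (n - j) = stencil4 i j" if "i + 4 \<le> n" "j \<le> n" for i j
    using that stencil4_reflect[of i j n] by (cases "4 \<le> i") (auto simp: a_def)
  have "eigenvalue_multiplicity
      ((1 / (48 * spacing n)) \<cdot>\<^sub>m mat (n + 1) (n + 1) (\<lambda>(i, j). a i j)) 0 = 1"
  proof (rule multiplicity_0_of_kernel_constant)
    show "1 / (48 * spacing n) \<noteq> 0" using n by (simp add: spacing_def)
    show "a i j = a j i" if "i \<le> n" "j \<le> n" for i j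
    proof (cases "i + 4 \<le> n \<longleftrightarrow> j + 4 \<le> n")
      case True
      then show ?thesis by (auto simp: a_def intro: stencil4_sym)
    next
      case False
      \<comment> \<open>One row is taken from the left description and the other from the right one. As \<open>n \<ge> 7\<close>, the
        entry is then in no corner block.\<close>
      then have "(4 \<le> i \<or> 4 \<le> j) \<and> (i + 4 \<le> n \<or> j + 4 \<le> n)" using n by linarith
      then have "stencil4 (n - i) (n - j) = stencil4 i j" using stencil4_reflect that by blast
      then show ?thesis
        using False stencil4_sym[of i j] stencil4_sym[of "n - i" "n - j"] by (auto simp: a_def)
    qed
    have stencil_sum: "(\<Sum>j\<le>n. stencil4 i j) = 0" if "i + 4 \<le> n" for i
      using sum_stencil4[OF n that, of "\<lambda>_. 1"] by (simp add: flux4_def forward_diff_def)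
    show "(\<Sum>j\<le>n. a i j) = 0" if "i \<le> n" for i
    proof (cases "i + 4 \<le> n")
      case True
      then show ?thesis using stencil_sum[of i] by (simp add: a_def)
    next
      case False
      with that n have "n - i + 4 \<le> n" by linarith
      with False show ?thesis
        using stencil_sum[of "n - i"] sum_atMost_rev[of "stencil4 (n - i)" n] by (simp add: a_def)
    qed
    fix x :: "nat \<Rightarrow> real" and i
    assume zero: "\<And>i. i \<le> n \<Longrightarrow> (\<Sum>j\<le>n. a i j * x j) = 0" and "i \<le> n"
    show "x i = x 0"
    proof (rule const_of_stencil4_eq_0[OF n _ _ \<open>i \<le> n\<close>])
      fix i assume i: "i + 4 \<le> n"
      then show "(\<Sum>j\<le>n. stencil4 i j * x j) = 0" using zero[of i] by (simp add: a_def)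
      have "(\<Sum>j\<le>n. stencil4 i j * x (n - j)) = (\<Sum>j\<le>n. a (n - i) (n - j) * x (n - j))"
        using i by (simp add: reflect)
      also have "\<dots> = 0" using zero[of "n - i"] by (simp add: sum_atMost_rev[of "\<lambda>j. a (n - i) j * x j"])
      finally show "(\<Sum>j\<le>n. stencil4 i j * x (n - j)) = 0" .
    qed
  qed
  then show ?thesis by (simp add: stiff4_def a_def)
qed

theorem corollary4p3:
  shows "(\<forall>n\<ge>2. eigenvalue_multiplicity (stiffA (mattsson_nordstrom2 n)) 0 = 1) \<and>
         (\<forall>n\<ge>7. eigenvalue_multiplicity (stiffA (mattsson_nordstrom4 n)) 0 = 1)"
  by (simp add: mattsson_nordstrom2_def mattsson_nordstrom4_def
      multiplicity_0_stiff2 multiplicity_0_stiff4)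

end
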